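(* Suppose there exist two distinct sellers $k,k'\in\mathcal A$ such that for all $i\in\mathcal I\setminus\mathcal A$, $$\lim_{v\to0}\frac{vF_i(v)}{F_k(v)}=0\quad\text{and}\quad\lim_{v\to0}\frac{vF_i(v)}{F_{k'}(v)}=0.$$ Then speculation in the second-price procurement auction is profitable: there is a vector of cutoffs $\bm v^*=(v_j^* )_{j\in\mathcal A}\in[0,r]^{\mathcal A}$ such that, when the speculator offers $p_j^*(\bm v^* )$ to each $j\in\mathcal A$, his expected profit in the equilibrium with cutoffs $\bm v^*$ is strictly positive.
   Context: Setting. Sellers $\mathcal I=\{1,\dots,N\}$, $N\ge2$, each own one item; values $v_i$ are independent, $v_i$ drawn from a CDF $F_i$ on $[0,1]$ with a density, $F_i(0)=0<F_i(v)$ for $v\in(0,1]$. An auctioneer buys one item by a reverse second-price auction with reserve $r\in(0,1]$: the lowest bid not exceeding $r$ wins and is paid the minimum of $r$ and the lowest competing bid. The speculator (value $0$ for items) can make take-it-or-leave-it offers $p_j$ only to sellers $j$ in a subset $\mathcal A\subseteq\mathcal I$; these simultaneously accept or reject. Then the auction is held among all sellers who still own their item and the speculator (if he acquired at least one item). Sellers bid truthfully; the speculator bids $0$ for one item and withholds the others, which are worth $0$. His profit is his auction revenue minus acquisition payments. For $\bm v^*=(v_j^* )_{j\in\mathcal A}$ with $v_j^*\in[0,r]$ let $$p_j^*(\bm v^* )=v_j^*+\int_{v_j^*}^r\prod_{i\in\mathcal I\setminus\mathcal A}[1-F_i(x)]\prod_{s\in\mathcal A\setminus\{j\}}[1-F_s(\max\{x,v_s^*\})]\,dx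 .$$ With offers $p_j=p_j^*(\bm v^* )$ there is a perfect Bayesian equilibrium in which each $j\in\mathcal A$ accepts iff $v_j<v_j^*$; this is the "equilibrium with cutoffs $\bm v^*$". *)

theory Defs
  imports "HOL-Probability.Probability"
begin

datatype bidder = Seller nat | Speculator

text \<open>
  Reverse second-price auction with reserve \<open>r\<close>, bidder set \<open>B\<close> and bids \<open>b\<close>. Ties are broken
  arbitrarily (by choice); a tied winner is paid its own bid, so no payoff below depends on this.
\<close>

definition auction_winner :: "real \<Rightarrow> bidder set \<Rightarrow> (bidder \<Rightarrow> real) \<Rightarrow> bidder option" where
  "auction_winner r B b =
     (if \<exists>x\<in>B. b x \<le> r then Some (arg_min_on b B) else None)"

definition auction_price :: "real \<Rightarrow> bidder set \<Rightarrow> (bidder \<Rightarrow> real) \<Rightarrow> bidder \<Rightarrow> real" where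
  "auction_price r B b w = Min (insert r (b ` (B - {w})))"

text \<open>
  \<open>S\<close> is the set of sellers whose item the speculator has acquired. He enters a single bid
  of 0 if \<open>S\<close> is nonempty; his remaining items are withheld.
\<close>

definition bidders :: "nat \<Rightarrow> nat set \<Rightarrow> bidder set" where
  "bidders N S = Seller ` ({1..N} - S) \<union> (if S = {} then {} else {Speculator})"

fun bid :: "(nat \<Rightarrow> real) \<Rightarrow> bidder \<Rightarrow> real" where
  "bid v (Seller i) = v i"
| "bid v Speculator = 0"

text \<open>
  An acceptance profile \<open>\<sigma>\<close> says whether seller \<open>j\<close> with value \<open>x\<close> accepts (\<open>\<sigma> j x\<close>).
\<close>

definition acquired :: "nat set \<Rightarrow> (nat \<Rightarrow> real \<Rightarrow> bool) \<Rightarrow> (nat \<Rightarrow> real) \<Rightarrow> nat set" where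
  "acquired A \<sigma> v = {j \<in> A. \<sigma> j (v j)}"

definition auction_revenue :: "nat \<Rightarrow> real \<Rightarrow> nat set \<Rightarrow> (nat \<Rightarrow> real) \<Rightarrow> real" where
  "auction_revenue N r S v =
     (if auction_winner r (bidders N S) (bid v) = Some Speculator
      then auction_price r (bidders N S) (bid v) Speculator else 0)"

definition speculator_profit ::
  "nat \<Rightarrow> nat set \<Rightarrow> real \<Rightarrow> (nat \<Rightarrow> real) \<Rightarrow> (nat \<Rightarrow> real \<Rightarrow> bool) \<Rightarrow> (nat \<Rightarrow> real) \<Rightarrow> real" where
  "speculator_profit N A r p \<sigma> v =
     auction_revenue N r (acquired A \<sigma> v) v - (\<Sum>j\<in>acquired A \<sigma> v. p j)"

definition expected_profit ::
  "'a measure \<Rightarrow> (nat \<Rightarrow> 'a \<Rightarrow> real) \<Rightarrow> nat \<Rightarrow> nat set \<Rightarrow> real \<Rightarrow>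
   (nat \<Rightarrow> real) \<Rightarrow> (nat \<Rightarrow> real \<Rightarrow> bool) \<Rightarrow> real" where
  "expected_profit M V N A r p \<sigma> =
     (\<integral>\<omega>. speculator_profit N A r p \<sigma> (\<lambda>i. V i \<omega>) \<partial>M)"

text \<open>
  Payoff of seller \<open>j\<close> after rejecting, at value profile \<open>v\<close>: the price if he wins the auction,
  and otherwise the value \<open>v j\<close> of the item he keeps.
\<close>

definition rejection_payoff ::
  "nat \<Rightarrow> nat set \<Rightarrow> real \<Rightarrow> (nat \<Rightarrow> real \<Rightarrow> bool) \<Rightarrow> nat \<Rightarrow> (nat \<Rightarrow> real) \<Rightarrow> real" where
  "rejection_payoff N A r \<sigma> j v =
     (let B = bidders N (acquired (A - {j}) \<sigma> v)
      in if auction_winner r B (bid v) = Some (Seller j)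
         then auction_price r B (bid v) (Seller j) else v j)"

text \<open>
  As values are independent, the expectation conditional on \<open>j\<close>'s value being \<open>x\<close> is
  obtained by overwriting the \<open>j\<close>-th value with \<open>x\<close>.
\<close>

definition expected_rejection_payoff ::
  "'a measure \<Rightarrow> (nat \<Rightarrow> 'a \<Rightarrow> real) \<Rightarrow> nat \<Rightarrow> nat set \<Rightarrow> real \<Rightarrow>
   (nat \<Rightarrow> real \<Rightarrow> bool) \<Rightarrow> nat \<Rightarrow> real \<Rightarrow> real" where
  "expected_rejection_payoff M V N A r \<sigma> j x =
     (\<integral>\<omega>. rejection_payoff N A r \<sigma> j ((\<lambda>i. V i \<omega>)(j := x)) \<partial>M)"

text \<open>
  Perfect Bayesian equilibrium following the offers \<open>p\<close>. Bidding in the auction is fixed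
  by the model and the offers reveal nothing about values, so beliefs are the prior and only the
  simultaneous accept/reject decisions have to be optimal, for every seller and every value.
  Accepting is worth exactly \<open>p j\<close>.
\<close>

definition acceptance_equilibrium ::
  "'a measure \<Rightarrow> (nat \<Rightarrow> 'a \<Rightarrow> real) \<Rightarrow> nat \<Rightarrow> nat set \<Rightarrow> real \<Rightarrow>
   (nat \<Rightarrow> real) \<Rightarrow> (nat \<Rightarrow> real \<Rightarrow> bool) \<Rightarrow> bool" where
  "acceptance_equilibrium M V N A r p \<sigma> \<longleftrightarrow>
     (\<forall>j\<in>A. \<forall>x\<in>{0..1}.
        (\<sigma> j x \<longrightarrow> expected_rejection_payoff M V N A r \<sigma> j x \<le> p j) \<and>
        (\<not> \<sigma> j x \<longrightarrow> p j \<le> expected_rejection_payoff M V N A r \<sigma> j x))"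

definition cutoff_profile :: "(nat \<Rightarrow> real) \<Rightarrow> nat \<Rightarrow> real \<Rightarrow> bool" where
  "cutoff_profile c j x \<longleftrightarrow> x < c j"

definition cutoff_offer ::
  "(nat \<Rightarrow> real \<Rightarrow> real) \<Rightarrow> nat \<Rightarrow> nat set \<Rightarrow> real \<Rightarrow> (nat \<Rightarrow> real) \<Rightarrow> nat \<Rightarrow> real" where
  "cutoff_offer F N A r c j =
     c j + (LBINT x:{c j..r}.
              (\<Prod>i\<in>{1..N} - A. 1 - F i x) * (\<Prod>s\<in>A - {j}. 1 - F s (max x (c s))))"

end

theory Submission
  imports Defs
begin

text \<open>
  Buy only from the two sellers \<open>j\<close> and \<open>l\<close> in \<open>A\<close> that are most likely to have a value below a
  small common cutoff \<open>a\<close>. An offer to \<open>j\<close> equals \<open>j\<close>'s expected payoff from rejecting with value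
  \<open>a\<close>: up to at most \<open>a\<close>, and only when some other value is below \<open>a\<close>, it is the expected resale
  price on the event that \<open>l\<close> rejects. So the speculator roughly breaks even when only one of them
  accepts, and the resale price when both accept is a gain. The profit is at least
  \<open>F j a * F l a * (\<mu> - 2 * a) - (F j a + F l a) * a * (\<Sum>i. F i a)\<close>, summed over the other
  sellers, where \<open>\<mu> > 0\<close> does not depend on \<open>a\<close>. Choosing the two largest \<open>F j a\<close> controls the
  remaining sellers in \<open>A\<close>, and the limit hypotheses control those outside \<open>A\<close>.
\<close>

section \<open>Lowest bids capped by the reserve\<close>

text \<open>Inserting \<open>r\<close> matches the pricing rule of the auction and keeps
  \<open>Min\<close> away from the empty set, so a bidder without rivals sells at
  \<open>r\<close>.\<close>

definition lowest_bid :: "real \<Rightarrow> nat set \<Rightarrow> (nat \<Rightarrow> real) \<Rightarrow> real" where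
  "lowest_bid r K b = Min (insert r (b ` K))"

lemma lowest_bid_empty [simp]: "lowest_bid r {} b = r"
  by (simp add: lowest_bid_def)

lemma lowest_bid_insert:
  "finite K \<Longrightarrow> lowest_bid r (insert i K) b = min (b i) (lowest_bid r K b)"
  by (simp add: lowest_bid_def insert_commute[of r])

lemma lowest_bid_cong:
  "(\<And>i. i \<in> K \<Longrightarrow> b i = b' i) \<Longrightarrow> lowest_bid r K b = lowest_bid r K b'"
  by (simp add: lowest_bid_def cong: image_cong)

lemma less_lowest_bid_iff:
  "finite K \<Longrightarrow> x < lowest_bid r K b \<longleftrightarrow> x < r \<and> (\<forall>i\<in>K. x < b i)"
  by (auto simp: lowest_bid_def)

lemma le_lowest_bid_iff:
  "finite K \<Longrightarrow> x \<le> lowest_bid r K b \<longleftrightarrow> x \<le> r \<and> (\<forall>i\<in>K. x \<le> b i)"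
  by (auto simp: lowest_bid_def)

lemma lowest_bid_le: "finite K \<Longrightarrow> lowest_bid r K b \<le> r"
  by (simp add: lowest_bid_def)

lemma lowest_bid_antimono:
  "finite K \<Longrightarrow> J \<subseteq> K \<Longrightarrow> lowest_bid r K b \<le> lowest_bid r J b"
  unfolding lowest_bid_def by (intro Min_antimono) auto

text \<open>Serves for the zero bid that the speculator enters as soon as one seller has accepted:
  the price for everyone else then drops to 0.\<close>

lemma lowest_bid_eq_0:
  assumes "finite K" "i \<in> K" "b i = 0" "\<And>i. i \<in> K \<Longrightarrow> 0 \<le> b i" "0 \<le> r"
  shows "lowest_bid r K b = 0"
  unfolding lowest_bid_def using assms by (intro Min_eqI) (auto intro: rev_image_eqI)

lemma borel_measurable_lowest_bid:
  assumes "finite K" "\<And>i. i \<in> K \<Longrightarrow> (\<lambda>\<omega>. X \<omega> i) \<in> borel_measurable M"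
  shows "(\<lambda>\<omega>. lowest_bid r K (X \<omega>)) \<in> borel_measurable M"
  using assms
proof (induction K)
  case (insert i K)
  have [measurable]: "(\<lambda>\<omega>. X \<omega> i) \<in> borel_measurable M"
    "(\<lambda>\<omega>. lowest_bid r K (X \<omega>)) \<in> borel_measurable M"
    using insert by auto
  show ?case
    using insert.hyps by (simp add: lowest_bid_insert)
qed simp

section \<open>Auction payoffs in closed form\<close>

text \<open>
  Truthful bidding turns the second-price auction into the option of selling at the lowest
  competing bid, hence the maximum.
\<close>

lemma auction_payoff_eq_max:
  assumes "finite B" "w \<in> B"
  shows "(if auction_winner r B b = Some w then auction_price r B b w else b w) =
    max (b w) (auction_price r B b w)"
proof (cases "auction_winner r B b = Some w")
  case True
  then have w: "w = arg_min_on b B" and "\<exists>x\<in>B. b x \<le> r"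
    by (auto simp: auction_winner_def split: if_splits)
  then have "b w \<le> r" "\<And>y. y \<in> B \<Longrightarrow> b w \<le> b y"
    using arg_min_least[OF assms(1), of _ b] by (auto intro: order_trans)
  then have "b w \<le> auction_price r B b w"
    using assms by (simp add: auction_price_def)
  then show ?thesis using True by simp
next
  case False
  \<comment> \<open>A loser faces a price no higher than its own bid: either the winner is a rival
    bidding at most \<open>b w\<close>, or nobody meets the reserve and
    \<open>r < b w\<close>.\<close>
  have "auction_price r B b w \<le> b w"
  proof (cases "\<exists>x\<in>B. b x \<le> r")
    case True
    define u where "u = arg_min_on b B"
    have "u \<in> B" "b u \<le> b w"
      using arg_min_if_finite(1)[of B b] arg_min_least[OF assms(1), of w b] assms
      by (auto simp: u_def)
    moreover have "u \<noteq> w"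
      using False True by (auto simp: auction_winner_def u_def)
    ultimately have "auction_price r B b w \<le> b u"
      using assms by (auto simp: auction_price_def)
    then show ?thesis using \<open>b u \<le> b w\<close> by simp
  next
    case False
    then have "r < b w" using assms(2) by force
    moreover have "auction_price r B b w \<le> r"
      using assms(1) by (simp add: auction_price_def)
    ultimately show ?thesis by simp
  qed
  then show ?thesis using False by simp
qed

lemma finite_bidders: "finite (bidders N S)"
  by (simp add: bidders_def)

text \<open>The speculator's single zero bid may be charged to every seller who accepted, because
  repeating a bid does not change the minimum. The index set of rivals thus stays
  \<open>{1..N} - {j}\<close>, whoever accepts.\<close>

lemma rejection_payoff_eq:
  assumes "A \<subseteq> {1..N}" "j \<in> {1..N}"
  shows "rejection_payoff N A r \<sigma> j v =
    max (v j) (lowest_bid r ({1..N} - {j}) (\<lambda>i. if i \<in> A \<and> \<sigma> i (v i) then 0 else v i))"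
proof -
  define S where "S = acquired (A - {j}) \<sigma> v"
  have S: "S = {i \<in> A - {j}. \<sigma> i (v i)}" by (simp add: S_def acquired_def)
  have j: "Seller j \<in> bidders N S" using assms by (auto simp: bidders_def S)
  have "bid v ` (bidders N S - {Seller j}) =
      (\<lambda>i. if i \<in> A \<and> \<sigma> i (v i) then 0 else v i) ` ({1..N} - {j})" (is "?L = ?g ` _")
  proof (intro equalityI subsetI)
    have "bidders N S - {Seller j} =
        Seller ` ({1..N} - S - {j}) \<union> (if S = {} then {} else {Speculator})"
      by (auto simp: bidders_def)
    then have L: "?L = v ` ({1..N} - S - {j}) \<union> (if S = {} then {} else {0})"
      by (simp add: image_Un image_image)
    fix y assume "y \<in> ?L"
    then have "y \<in> v ` ({1..N} - S - {j}) \<or> S \<noteq> {} \<and> y = 0"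
      unfolding L by (auto split: if_splits)
    then consider i where "i \<in> {1..N} - S - {j}" "y = v i" | i where "i \<in> S" "y = 0"
      by blast
    then show "y \<in> ?g ` ({1..N} - {j})"
    proof cases
      case 1
      then show ?thesis by (intro image_eqI[of _ _ i]) (auto simp: S)
    next
      case 2
      then show ?thesis using assms(1) by (intro image_eqI[of _ _ i]) (auto simp: S)
    qed
  next
    fix y assume "y \<in> ?g ` ({1..N} - {j})"
    then obtain i where i: "i \<in> {1..N} - {j}" "y = ?g i" by blast
    show "y \<in> ?L"
    proof (cases "i \<in> S")
      case True
      then show ?thesis using i by (intro image_eqI[of _ _ Speculator]) (auto simp: bidders_def S)
    next
      case False
      then show ?thesis using i
        by (intro image_eqI[of _ _ "Seller i"]) (auto simp: bidders_def S)
    qed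
  qed
  then have "auction_price r (bidders N S) (bid v) (Seller j) = lowest_bid r ({1..N} - {j}) ?g"
    by (simp add: auction_price_def lowest_bid_def)
  moreover have "rejection_payoff N A r \<sigma> j v =
      (if auction_winner r (bidders N S) (bid v) = Some (Seller j)
       then auction_price r (bidders N S) (bid v) (Seller j) else bid v (Seller j))"
    by (simp add: rejection_payoff_def S_def Let_def)
  moreover have "\<dots> = max (bid v (Seller j)) (auction_price r (bidders N S) (bid v) (Seller j))"
    by (rule auction_payoff_eq_max[OF finite_bidders j])
  ultimately show ?thesis by simp
qed

text \<open>The speculator is a truthful bidder with value 0, so his revenue is the maximum of 0 and
  the lowest competing bid. That bid is nonnegative, so ties at 0 do no harm.\<close>

lemma auction_revenue_eq:
  assumes "0 \<le> r" "\<And>i. i \<in> {1..N} \<Longrightarrow> 0 \<le> v i"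
  shows "auction_revenue N r S v = (if S = {} then 0 else lowest_bid r ({1..N} - S) v)"
proof (cases "S = {}")
  case True
  then have "Speculator \<notin> bidders N S" by (auto simp: bidders_def)
  then have "auction_winner r (bidders N S) (bid v) \<noteq> Some Speculator"
    using arg_min_if_finite(1)[OF finite_bidders, of N S "bid v"]
    by (metis auction_winner_def empty_iff option.distinct(1) option.inject)
  then show ?thesis using True by (simp add: auction_revenue_def)
next
  case False
  then have sp: "Speculator \<in> bidders N S" by (simp add: bidders_def)
  have "bidders N S - {Speculator} = Seller ` ({1..N} - S)"
    by (auto simp: bidders_def)
  then have "bid v ` (bidders N S - {Speculator}) = v ` ({1..N} - S)"
    by (simp add: image_image)
  then have "auction_price r (bidders N S) (bid v) Speculator = lowest_bid r ({1..N} - S) v"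
    by (simp add: auction_price_def lowest_bid_def)
  moreover have "0 \<le> lowest_bid r ({1..N} - S) v"
    using assms by (simp add: le_lowest_bid_iff)
  ultimately show ?thesis
    using auction_payoff_eq_max[OF finite_bidders sp, of r "bid v"] False
    by (simp add: auction_revenue_def split: if_splits)
qed

section \<open>Independent atomless values\<close>

text \<open>The density is replaced by its consequence \<open>atomless\<close>: weak and strict tail
  events then have equal probability. This matters because a seller exactly at the cutoff
  rejects.\<close>

locale procurement = prob_space M for M :: "'a measure" +
  fixes V :: "nat \<Rightarrow> 'a \<Rightarrow> real" and N :: nat and A :: "nat set" and r :: real
    and F :: "nat \<Rightarrow> real \<Rightarrow> real"
  assumes N_ge_2: "2 \<le> N" and A_subset: "A \<subseteq> {1..N}" and r_pos: "0 < r"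
    and indep: "indep_vars (\<lambda>_. borel) V {1..N}"
    and V_range: "\<And>i \<omega>. i \<in> {1..N} \<Longrightarrow> \<omega> \<in> space M \<Longrightarrow> V i \<omega> \<in> {0..1}"
    and F_eq: "\<And>i x. i \<in> {1..N} \<Longrightarrow> F i x = prob {\<omega> \<in> space M. V i \<omega> \<le> x}"
    and atomless: "\<And>i x. i \<in> {1..N} \<Longrightarrow> prob {\<omega> \<in> space M. V i \<omega> = x} = 0"
begin

lemma V_measurable: "i \<in> {1..N} \<Longrightarrow> V i \<in> borel_measurable M"
  using indep by (auto simp: indep_vars_def)

lemma V_nonneg: "i \<in> {1..N} \<Longrightarrow> \<omega> \<in> space M \<Longrightarrow> 0 \<le> V i \<omega>"
  using V_range by auto

lemma prob_greater:
  assumes "i \<in> {1..N}"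
  shows "prob {\<omega> \<in> space M. x < V i \<omega>} = 1 - F i x"
proof -
  note [measurable] = V_measurable[OF assms]
  show ?thesis
    using prob_neg[of "\<lambda>\<omega>. V i \<omega> \<le> x"] by (simp add: F_eq[OF assms] not_le)
qed

lemma prob_less:
  assumes "i \<in> {1..N}"
  shows "prob {\<omega> \<in> space M. V i \<omega> < x} = F i x"
proof -
  note [measurable] = V_measurable[OF assms]
  have "{\<omega> \<in> space M. V i \<omega> \<le> x} = {\<omega> \<in> space M. V i \<omega> < x} \<union> {\<omega> \<in> space M. V i \<omega> = x}"
    by auto
  then have "F i x = prob {\<omega> \<in> space M. V i \<omega> < x} + prob {\<omega> \<in> space M. V i \<omega> = x}"
    by (simp add: F_eq[OF assms] finite_measure_Union disjoint_iff)
  then show ?thesis by (simp add: atomless[OF assms])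
qed

lemma prob_ge:
  assumes "i \<in> {1..N}"
  shows "prob {\<omega> \<in> space M. x \<le> V i \<omega>} = 1 - F i x"
proof -
  note [measurable] = V_measurable[OF assms]
  show ?thesis
    using prob_neg[of "\<lambda>\<omega>. V i \<omega> < x"] by (simp add: prob_less[OF assms] not_less)
qed

lemma F_nonneg: "i \<in> {1..N} \<Longrightarrow> 0 \<le> F i x"
  by (simp add: F_eq)

lemma F_mono:
  assumes "i \<in> {1..N}" "x \<le> y"
  shows "F i x \<le> F i y"
proof -
  note [measurable] = V_measurable[OF assms(1)]
  show ?thesis
    unfolding F_eq[OF assms(1)] using assms(2) by (intro finite_measure_mono) auto
qed

section \<open>Law of the competing bid, offers and equilibrium\<close>

text \<open>The price that \<open>j\<close> faces after rejecting when the others follow the cutoffs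
  \<open>c\<close>. It ignores \<open>j\<close>'s own value, so by
  \<open>rejection_payoff_eq\<close> a rejecting seller with value \<open>x\<close> gets the maximum
  of \<open>x\<close> and this variable.\<close>

definition competition :: "(nat \<Rightarrow> real) \<Rightarrow> nat \<Rightarrow> 'a \<Rightarrow> real" where
  "competition c j \<omega> =
     lowest_bid r ({1..N} - {j}) (\<lambda>i. if i \<in> A \<and> V i \<omega> < c i then 0 else V i \<omega>)"

lemma competition_measurable [measurable]: "competition c j \<in> borel_measurable M"
proof -
  have "(\<lambda>\<omega>. lowest_bid r ({1..N} - {j}) (\<lambda>i. if i \<in> A \<and> V i \<omega> < c i then 0 else V i \<omega>))
      \<in> borel_measurable M"
  proof (rule borel_measurable_lowest_bid)
    fix i assume "i \<in> {1..N} - {j}"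
    then have [measurable]: "V i \<in> borel_measurable M" by (intro V_measurable) auto
    show "(\<lambda>\<omega>. if i \<in> A \<and> V i \<omega> < c i then 0 else V i \<omega>) \<in> borel_measurable M"
      by measurable
  qed simp
  then show ?thesis by (simp add: competition_def[abs_def])
qed

lemma competition_le: "competition c j \<omega> \<le> r"
  by (simp add: competition_def lowest_bid_le)

lemma competition_nonneg: "\<omega> \<in> space M \<Longrightarrow> 0 \<le> competition c j \<omega>"
  using r_pos V_nonneg by (simp add: competition_def le_lowest_bid_iff)

lemma competition_integrable: "integrable M (\<lambda>\<omega>. max x (competition c j \<omega>))"
proof (rule integrable_const_bound[where B="\<bar>x\<bar> + r"])
  show "AE \<omega> in M. norm (max x (competition c j \<omega>)) \<le> \<bar>x\<bar> + r"
  proof (rule AE_I2)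
    fix \<omega> assume "\<omega> \<in> space M"
    then show "norm (max x (competition c j \<omega>)) \<le> \<bar>x\<bar> + r"
      using competition_le[of c j \<omega>] competition_nonneg[of \<omega> c j] by auto
  qed
qed measurable

text \<open>For \<open>x\<close> in \<open>[0, r)\<close> the price exceeds \<open>x\<close> iff
  every rival outside \<open>A\<close> has a value above \<open>x\<close> and every rival in
  \<open>A\<close> both rejects and has a value above \<open>x\<close>. These are independent
  events, one per rival.\<close>

lemma prob_less_competition:
  assumes "j \<in> A" "0 \<le> x" "x < r"
  shows "prob {\<omega> \<in> space M. x < competition c j \<omega>} =
    (\<Prod>i\<in>{1..N} - A. 1 - F i x) * (\<Prod>s\<in>A - {j}. 1 - F s (max x (c s)))"
proof -
  \<comment> \<open>\<open>B i\<close> collects the values for which the effective bid of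
    \<open>i\<close> exceeds \<open>x\<close>. For \<open>i\<close> in \<open>A\<close> it is the
    intersection of \<open>{c i..}\<close> and \<open>{x<..}\<close>, a half-line starting at the
    larger endpoint.\<close>
  define B where "B i = (if i \<in> A then if c i \<le> x then {x<..} else {c i..} else {x<..})" for i
  have j: "j \<in> {1..N}" using assms A_subset by auto
  \<comment> \<open>\<open>indep_varsD\<close> requires a nonempty index set; a rival exists because
    \<open>N\<close> is at least 2.\<close>
  have ne: "{1..N} - {j} \<noteq> {}"
  proof -
    have "(if j = 1 then 2 else 1) \<in> {1..N} - {j}" using N_ge_2 by auto
    then show ?thesis by blast
  qed
  have "{\<omega> \<in> space M. x < competition c j \<omega>} = (\<Inter>i\<in>{1..N} - {j}. V i -` B i \<inter> space M)"
    using ne assms by (auto simp: competition_def less_lowest_bid_iff B_def not_less split: if_splits)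
  then have "prob {\<omega> \<in> space M. x < competition c j \<omega>} =
      (\<Prod>i\<in>{1..N} - {j}. prob (V i -` B i \<inter> space M))"
    using indep_varsD[OF indep ne, of B] by (auto simp: B_def)
  also have "{1..N} - {j} = ({1..N} - A) \<union> (A - {j})"
    using A_subset assms by auto
  also have "(\<Prod>i\<in>\<dots>. prob (V i -` B i \<inter> space M)) =
      (\<Prod>i\<in>{1..N} - A. prob (V i -` B i \<inter> space M)) * (\<Prod>i\<in>A - {j}. prob (V i -` B i \<inter> space M))"
    using A_subset finite_subset by (intro prod.union_disjoint) auto
  also have "(\<Prod>i\<in>{1..N} - A. prob (V i -` B i \<inter> space M)) = (\<Prod>i\<in>{1..N} - A. 1 - F i x)"
  proof (intro prod.cong refl)
    fix i assume i: "i \<in> {1..N} - A"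
    then have "V i -` B i \<inter> space M = {\<omega> \<in> space M. x < V i \<omega>}" by (auto simp: B_def)
    then show "prob (V i -` B i \<inter> space M) = 1 - F i x" using i prob_greater by simp
  qed
  also have "(\<Prod>i\<in>A - {j}. prob (V i -` B i \<inter> space M)) = (\<Prod>s\<in>A - {j}. 1 - F s (max x (c s)))"
  proof (intro prod.cong refl)
    fix i assume i: "i \<in> A - {j}"
    then have "V i -` B i \<inter> space M =
        (if c i \<le> x then {\<omega> \<in> space M. x < V i \<omega>} else {\<omega> \<in> space M. c i \<le> V i \<omega>})"
      by (auto simp: B_def)
    moreover have "i \<in> {1..N}" using i A_subset by auto
    ultimately show "prob (V i -` B i \<inter> space M) = 1 - F i (max x (c i))"
      using prob_greater[of i x] prob_ge[of i "c i"] by (simp add: max_def)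
  qed
  finally show ?thesis .
qed

text \<open>
  The layer-cake formula: the integrand in the offer is the tail probability of the lowest
  competing bid.
\<close>

lemma cutoff_offer_eq:
  assumes "j \<in> A" "0 \<le> c j" "c j \<le> r"
  shows "cutoff_offer F N A r c j = expectation (\<lambda>\<omega>. max (c j) (competition c j \<omega>))"
proof -
  interpret P: pair_sigma_finite M lborel ..
  \<comment> \<open>Integrating \<open>g\<close> over \<open>x\<close> gives the excess of the
    maximum over \<open>c j\<close>; integrating it over \<open>\<omega>\<close> gives the tail
    probability on \<open>[c j, r]\<close>. Fubini equates the two iterated integrals.\<close>
  define g :: "'a \<Rightarrow> real \<Rightarrow> real"
    where "g \<omega> x = indicator ({c j..r} \<inter> {..<competition c j \<omega>}) x" for \<omega> x
  have g: "g \<omega> x = indicator {c j..r} x * (if x < competition c j \<omega> then 1 else 0)" for \<omega> x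
    by (auto simp: g_def split: split_indicator)
  have int: "integrable (M \<Otimes>\<^sub>M lborel) (case_prod g)"
  proof (rule integrableI_bounded_set[where A="space M \<times> {c j..r}" and B=1])
    show "case_prod g \<in> borel_measurable (M \<Otimes>\<^sub>M lborel)"
      unfolding g[abs_def] by measurable
    show "emeasure (M \<Otimes>\<^sub>M lborel) (space M \<times> {c j..r}) < \<infinity>"
      using assms by (subst lborel.emeasure_pair_measure_Times) (auto simp: emeasure_space_1)
    show "AE p in M \<Otimes>\<^sub>M lborel. p \<notin> space M \<times> {c j..r} \<longrightarrow> case_prod g p = 0"
      by (intro AE_I2) (auto simp: g_def space_pair_measure indicator_def)
  qed (auto simp: g_def split: split_indicator)
  have "(LBINT x. expectation (\<lambda>\<omega>. g \<omega> x)) = expectation (\<lambda>\<omega>. LBINT x. g \<omega> x)"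
    by (rule P.Fubini_integral[OF int])
  also have "\<dots> = expectation (\<lambda>\<omega>. max (c j) (competition c j \<omega>) - c j)"
  proof (intro Bochner_Integration.integral_cong refl)
    fix \<omega>
    have "{c j..r} \<inter> {..<competition c j \<omega>} = {c j..<competition c j \<omega>}"
      using competition_le[of c j \<omega>] by auto
    then show "(LBINT x. g \<omega> x) = max (c j) (competition c j \<omega>) - c j"
      by (simp add: g_def max_def)
  qed
  also have "\<dots> = expectation (\<lambda>\<omega>. max (c j) (competition c j \<omega>)) - c j"
    using competition_integrable by (simp add: prob_space)
  also have "(LBINT x. expectation (\<lambda>\<omega>. g \<omega> x)) =
      (LBINT x:{c j..r}. (\<Prod>i\<in>{1..N} - A. 1 - F i x) * (\<Prod>s\<in>A - {j}. 1 - F s (max x (c s))))"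
    unfolding set_lebesgue_integral_def
  proof (rule integral_cong_AE)
    \<comment> \<open>The tail formula needs \<open>x < r\<close>; the omitted endpoint is a
      Lebesgue null set.\<close>
    have "expectation (\<lambda>\<omega>. g \<omega> x) = indicator {c j..r} x *\<^sub>R
        ((\<Prod>i\<in>{1..N} - A. 1 - F i x) * (\<Prod>s\<in>A - {j}. 1 - F s (max x (c s))))" if "x \<noteq> r" for x
    proof (cases "x \<in> {c j..r}")
      case True
      have "expectation (\<lambda>\<omega>. g \<omega> x) = expectation (indicator {\<omega> \<in> space M. x < competition c j \<omega>})"
        using True by (intro Bochner_Integration.integral_cong) (auto simp: g split: split_indicator)
      also have "\<dots> = prob {\<omega> \<in> space M. x < competition c j \<omega>}" by simp
      finally show ?thesis
        using True that assms prob_less_competition[of j x c] by simp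
    qed (simp add: g)
    then show "AE x in lborel. expectation (\<lambda>\<omega>. g \<omega> x) = indicator {c j..r} x *\<^sub>R
        ((\<Prod>i\<in>{1..N} - A. 1 - F i x) * (\<Prod>s\<in>A - {j}. 1 - F s (max x (c s))))"
      using AE_lborel_singleton[of r] by (auto elim: eventually_mono)
  next
    show "(\<lambda>x. expectation (\<lambda>\<omega>. g \<omega> x)) \<in> borel_measurable lborel"
      unfolding g by measurable
    \<comment> \<open>Each factor is measurable because the distribution functions are
      monotone.\<close>
    have "(\<lambda>x. (\<Prod>i\<in>{1..N} - A. 1 - F i x) * (\<Prod>s\<in>A - {j}. 1 - F s (max x (c s))))
        \<in> borel_measurable borel"
      using A_subset
      by (intro borel_measurable_times borel_measurable_prod borel_measurable_diff
          borel_measurable_const borel_measurable_mono monoI F_mono) auto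
    then show "(\<lambda>x. indicator {c j..r} x *\<^sub>R ((\<Prod>i\<in>{1..N} - A. 1 - F i x) *
        (\<Prod>s\<in>A - {j}. 1 - F s (max x (c s))))) \<in> borel_measurable lborel"
      by measurable
  qed
  finally show ?thesis by (simp add: cutoff_offer_def)
qed

text \<open>The expected payoff from rejecting is nondecreasing in the seller's own value, and by
  \<open>cutoff_offer_eq\<close> the offer equals this payoff at the cutoff. So accepting is optimal
  below the cutoff and rejecting is optimal from it on.\<close>

lemma acceptance_equilibrium_cutoff:
  assumes "\<And>j. j \<in> A \<Longrightarrow> c j \<in> {0..r}"
  shows "acceptance_equilibrium M V N A r (cutoff_offer F N A r c) (cutoff_profile c)"
proof -
  have payoff: "expected_rejection_payoff M V N A r (cutoff_profile c) j x =
      expectation (\<lambda>\<omega>. max x (competition c j \<omega>))" if "j \<in> A" for j x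
  proof -
    have "j \<in> {1..N}" using that A_subset by auto
    \<comment> \<open>Overwriting \<open>j\<close>'s value is invisible here, since \<open>j\<close>
      is not among the rivals.\<close>
    moreover have "lowest_bid r ({1..N} - {j}) (\<lambda>i. if i \<in> A \<and> cutoff_profile c i (((\<lambda>i. V i \<omega>)(j := x)) i)
        then 0 else ((\<lambda>i. V i \<omega>)(j := x)) i) = competition c j \<omega>" for \<omega>
      unfolding competition_def cutoff_profile_def by (rule lowest_bid_cong) auto
    ultimately have "rejection_payoff N A r (cutoff_profile c) j ((\<lambda>i. V i \<omega>)(j := x)) =
        max x (competition c j \<omega>)" for \<omega>
      by (simp only: rejection_payoff_eq[OF A_subset] fun_upd_same)
    then show ?thesis by (simp add: expected_rejection_payoff_def)
  qed
  have mono: "expectation (\<lambda>\<omega>. max x (competition c j \<omega>)) \<le>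
      expectation (\<lambda>\<omega>. max y (competition c j \<omega>))" if "x \<le> y" for x y j
    using that by (intro integral_mono competition_integrable) auto
  show ?thesis
    unfolding acceptance_equilibrium_def
  proof (intro ballI)
    fix j x assume j: "j \<in> A"
    then have "cutoff_offer F N A r c j = expectation (\<lambda>\<omega>. max (c j) (competition c j \<omega>))"
      using assms by (intro cutoff_offer_eq) auto
    then show "(cutoff_profile c j x \<longrightarrow>
          expected_rejection_payoff M V N A r (cutoff_profile c) j x \<le> cutoff_offer F N A r c j) \<and>
        (\<not> cutoff_profile c j x \<longrightarrow>
          cutoff_offer F N A r c j \<le> expected_rejection_payoff M V N A r (cutoff_profile c) j x)"
      using mono[of x "c j" j] mono[of "c j" x j] by (simp add: payoff[OF j] cutoff_profile_def)
  qed
qed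

section \<open>Expectations over disjoint groups of sellers\<close>

text \<open>Functions of disjoint blocks of independent values are independent. The bound is asked
  for nonnegative arguments only, because \<open>lowest_bid\<close> has no lower bound on arbitrary
  ones while the values are nonnegative.\<close>

lemma expectation_mult_indep:
  fixes g h :: "(nat \<Rightarrow> real) \<Rightarrow> real"
  assumes "J \<union> K \<subseteq> {1..N}" "J \<inter> K = {}"
    and [measurable]: "g \<in> borel_measurable (PiM J (\<lambda>_. borel))" "h \<in> borel_measurable (PiM K (\<lambda>_. borel))"
    and "\<And>u. (\<And>i. i \<in> J \<Longrightarrow> 0 \<le> u i) \<Longrightarrow> \<bar>g u\<bar> \<le> B" "\<And>u. (\<And>i. i \<in> K \<Longrightarrow> 0 \<le> u i) \<Longrightarrow> \<bar>h u\<bar> \<le> B"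
  shows "expectation (\<lambda>\<omega>. g (\<lambda>i\<in>J. V i \<omega>) * h (\<lambda>i\<in>K. V i \<omega>)) =
    expectation (\<lambda>\<omega>. g (\<lambda>i\<in>J. V i \<omega>)) * expectation (\<lambda>\<omega>. h (\<lambda>i\<in>K. V i \<omega>))"
proof (rule indep_var_lebesgue_integral)
  show "indep_var borel (\<lambda>\<omega>. g (\<lambda>i\<in>J. V i \<omega>)) borel (\<lambda>\<omega>. h (\<lambda>i\<in>K. V i \<omega>))"
    using indep_var_compose[OF indep_var_restrict[OF indep assms(2)] assms(3,4)] assms(1)
    by (simp add: comp_def)
  have [measurable]: "(\<lambda>\<omega>. \<lambda>i\<in>L. V i \<omega>) \<in> measurable M (PiM L (\<lambda>_. borel))" if "L \<subseteq> {1..N}" for L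
    using that V_measurable by (intro measurable_restrict) auto
  have nonneg: "0 \<le> (\<lambda>i\<in>L. V i \<omega>) i" if "L \<subseteq> {1..N}" "i \<in> L" "\<omega> \<in> space M" for L i \<omega>
    using that V_nonneg[of i \<omega>] by auto
  have JK: "J \<subseteq> {1..N}" "K \<subseteq> {1..N}" using assms(1) by auto
  show "integrable M (\<lambda>\<omega>. g (\<lambda>i\<in>J. V i \<omega>))"
    using JK by (intro integrable_const_bound[where B=B] AE_I2)
      (auto simp only: real_norm_def intro!: assms(5) nonneg, measurable)
  show "integrable M (\<lambda>\<omega>. h (\<lambda>i\<in>K. V i \<omega>))"
    using JK by (intro integrable_const_bound[where B=B] AE_I2)
      (auto simp only: real_norm_def intro!: assms(6) nonneg, measurable)
qed

abbreviation (input) below :: "real \<Rightarrow> nat \<Rightarrow> 'a \<Rightarrow> real" where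
  "below a i \<omega> \<equiv> indicator {..<a} (V i \<omega>)"

lemma has_integral_below:
  assumes i: "i \<in> {1..N}"
  shows "has_bochner_integral M (below a i) (F i a)"
proof -
  note [measurable] = V_measurable[OF i]
  have "expectation (below a i) = expectation (indicator {\<omega> \<in> space M. V i \<omega> < a})"
    by (intro Bochner_Integration.integral_cong) (auto split: split_indicator)
  moreover have "integrable M (below a i)"
    by (intro integrable_const_bound[where B=1]) auto
  ultimately show ?thesis
    using prob_less[OF i] by (simp add: has_bochner_integral_iff)
qed

text \<open>Takes the acceptance event of \<open>j\<close> out of an expectation whose other factor
  depends only on sellers different from \<open>j\<close>.\<close>

lemma expectation_below_mult:
  assumes j: "j \<in> {1..N}" "j \<notin> K" "K \<subseteq> {1..N}"
    and h: "h \<in> borel_measurable (PiM K (\<lambda>_. borel))"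
    and B: "\<And>u. (\<And>i. i \<in> K \<Longrightarrow> 0 \<le> u i) \<Longrightarrow> \<bar>h u\<bar> \<le> B"
  shows "expectation (\<lambda>\<omega>. below a j \<omega> * h (\<lambda>i\<in>K. V i \<omega>)) =
    F j a * expectation (\<lambda>\<omega>. h (\<lambda>i\<in>K. V i \<omega>))"
proof -
  have "expectation (\<lambda>\<omega>. indicator {..<a} ((\<lambda>i\<in>{j}. V i \<omega>) j) * h (\<lambda>i\<in>K. V i \<omega>)) =
      expectation (\<lambda>\<omega>. indicator {..<a} ((\<lambda>i\<in>{j}. V i \<omega>) j)) * expectation (\<lambda>\<omega>. h (\<lambda>i\<in>K. V i \<omega>))"
  proof (rule expectation_mult_indep[where B="max 1 B" and g="\<lambda>u. indicator {..<a} (u j)"])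
    show "(\<lambda>u. indicator {..<a} (u j)) \<in> borel_measurable (PiM {j} (\<lambda>_. borel :: real measure))"
      by measurable
  qed (use j h B in \<open>auto intro: max.coboundedI2 split: split_indicator\<close>)
  then show ?thesis
    using has_bochner_integral_integral_eq[OF has_integral_below[OF j(1)]] by simp
qed

lemma lowest_bid_V_measurable:
  "K \<subseteq> {1..N} \<Longrightarrow> (\<lambda>\<omega>. lowest_bid r K (\<lambda>i. V i \<omega>)) \<in> borel_measurable M"
  using finite_subset V_measurable by (intro borel_measurable_lowest_bid) auto

lemma lowest_bid_V_nonneg:
  "K \<subseteq> {1..N} \<Longrightarrow> \<omega> \<in> space M \<Longrightarrow> 0 \<le> lowest_bid r K (\<lambda>i. V i \<omega>)"
  using finite_subset[of K "{1..N}"] V_nonneg r_pos by (auto simp: le_lowest_bid_iff)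

lemma lowest_bid_V_le:
  "K \<subseteq> {1..N} \<Longrightarrow> lowest_bid r K (\<lambda>i. V i \<omega>) \<le> r"
  using finite_subset[of K "{1..N}"] lowest_bid_le by auto

text \<open>Since \<open>F i 0 = 0\<close>, all of the finitely many values are almost surely
  positive, hence so is their minimum with \<open>r\<close>. This expectation bounds the resale
  price from below independently of the cutoff.\<close>

lemma expectation_lowest_bid_pos:
  assumes "\<And>i. i \<in> {1..N} \<Longrightarrow> F i 0 = 0"
  shows "0 < expectation (\<lambda>\<omega>. lowest_bid r {1..N} (\<lambda>i. V i \<omega>))"
proof -
  have "AE \<omega> in M. 0 < V i \<omega>" if "i \<in> {1..N}" for i
  proof -
    note [measurable] = V_measurable[OF that]
    have "prob {\<omega> \<in> space M. 0 < V i \<omega>} = 1"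
      using prob_greater[OF that] assms[OF that] by simp
    then show ?thesis by (simp add: prob_Collect_eq_1)
  qed
  then have "AE \<omega> in M. \<forall>i\<in>{1..N}. 0 < V i \<omega>"
    by (intro AE_finite_allI) auto
  then have pos: "AE \<omega> in M. 0 < lowest_bid r {1..N} (\<lambda>i. V i \<omega>)"
    using r_pos by (simp add: less_lowest_bid_iff)
  have "integrable M (\<lambda>\<omega>. lowest_bid r {1..N} (\<lambda>i. V i \<omega>))"
    using lowest_bid_V_le lowest_bid_V_nonneg
    by (intro integrable_const_bound[where B=r] AE_I2 lowest_bid_V_measurable) auto
  from integral_less_AE_space[OF integrable_zero this pos] show ?thesis
    by (simp add: emeasure_space_1)
qed

section \<open>Profit from buying from two sellers\<close>

text \<open>Cutoff 0 switches off the remaining sellers in \<open>A\<close>: no nonnegative value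
  lies strictly below it.\<close>

definition pair_cutoff :: "nat \<Rightarrow> nat \<Rightarrow> real \<Rightarrow> nat \<Rightarrow> real" where
  "pair_cutoff j l a i = (if i = j \<or> i = l then a else 0)"

lemma pair_cutoff_commute: "pair_cutoff j l = pair_cutoff l j"
  by (auto simp: pair_cutoff_def fun_eq_iff)

lemma competition_pair_cutoff:
  assumes "j \<in> A" "l \<in> A" "j \<noteq> l" "\<omega> \<in> space M"
  shows "competition (pair_cutoff j l a) j \<omega> =
    (if V l \<omega> < a then 0 else lowest_bid r ({1..N} - {j}) (\<lambda>i. V i \<omega>))"
proof (cases "V l \<omega> < a")
  case True
  have "lowest_bid r ({1..N} - {j})
      (\<lambda>i. if i \<in> A \<and> V i \<omega> < pair_cutoff j l a i then 0 else V i \<omega>) = 0"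
  proof (rule lowest_bid_eq_0[of _ l])
    show "0 \<le> (if i \<in> A \<and> V i \<omega> < pair_cutoff j l a i then 0 else V i \<omega>)"
      if "i \<in> {1..N} - {j}" for i
      using that V_nonneg[of i, OF _ assms(4)] by auto
  qed (use True assms A_subset r_pos in \<open>auto simp: pair_cutoff_def\<close>)
  then show ?thesis using True by (simp add: competition_def)
next
  case False
  have "lowest_bid r ({1..N} - {j})
      (\<lambda>i. if i \<in> A \<and> V i \<omega> < pair_cutoff j l a i then 0 else V i \<omega>) =
    lowest_bid r ({1..N} - {j}) (\<lambda>i. V i \<omega>)"
  proof (rule lowest_bid_cong)
    fix i assume "i \<in> {1..N} - {j}"
    then show "(if i \<in> A \<and> V i \<omega> < pair_cutoff j l a i then 0 else V i \<omega>) = V i \<omega>"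
      using False V_nonneg[of i, OF _ assms(4)] by (auto simp: pair_cutoff_def)
  qed
  then show ?thesis using False by (simp add: competition_def)
qed

text \<open>The offer is the mean of the maximum of \<open>a\<close> and the competing bid. If
  \<open>l\<close> accepts, that bid is 0 and the maximum is \<open>a\<close>. If \<open>l\<close>
  rejects, the maximum exceeds the bid by at most \<open>a\<close>, and only when a third seller is
  below \<open>a\<close>; a union bound over those sellers gives the sum.\<close>

lemma offer_le:
  assumes "j \<in> A" "l \<in> A" "j \<noteq> l" "0 \<le> a" "a \<le> r"
  shows "cutoff_offer F N A r (pair_cutoff j l a) j \<le>
    expectation (\<lambda>\<omega>. (1 - below a l \<omega>) * lowest_bid r ({1..N} - {j}) (\<lambda>i. V i \<omega>)) +
    a * F l a + a * (\<Sum>i\<in>{1..N} - {j, l}. F i a)" (is "_ \<le> expectation ?Q + _ + _")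
proof -
  have jl: "j \<in> {1..N}" "l \<in> {1..N}" using assms A_subset by auto
  have below: "below a i \<in> borel_measurable M" if "i \<in> {1..N}" for i
    using V_measurable[OF that] by measurable
  have Q_int: "integrable M ?Q"
  proof (rule integrable_const_bound[where B=r])
    show "?Q \<in> borel_measurable M"
      using below[OF jl(2)] lowest_bid_V_measurable[of "{1..N} - {j}"] by measurable
    show "AE \<omega> in M. norm (?Q \<omega>) \<le> r"
      using lowest_bid_V_nonneg[of "{1..N} - {j}"] lowest_bid_V_le[of "{1..N} - {j}"] r_pos
      by (intro AE_I2) (auto split: split_indicator)
  qed
  have int: "has_bochner_integral M
      (\<lambda>\<omega>. ?Q \<omega> + a * below a l \<omega> + a * (\<Sum>i\<in>{1..N} - {j, l}. below a i \<omega>))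
      (expectation ?Q + a * F l a + a * (\<Sum>i\<in>{1..N} - {j, l}. F i a))"
    using jl Q_int
    by (intro has_bochner_integral_add has_bochner_integral_mult_right has_bochner_integral_sum
        has_integral_below has_bochner_integral_integrable) auto
  have "cutoff_offer F N A r (pair_cutoff j l a) j =
      expectation (\<lambda>\<omega>. max a (competition (pair_cutoff j l a) j \<omega>))"
    using assms by (subst cutoff_offer_eq) (auto simp: pair_cutoff_def)
  also have "\<dots> \<le> expectation (\<lambda>\<omega>. ?Q \<omega> + a * below a l \<omega> + a * (\<Sum>i\<in>{1..N} - {j, l}. below a i \<omega>))"
  proof (rule integral_mono)
    show "integrable M (\<lambda>\<omega>. ?Q \<omega> + a * below a l \<omega> + a * (\<Sum>i\<in>{1..N} - {j, l}. below a i \<omega>))"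
      using int by (rule integrable.intros)
    fix \<omega> assume \<omega>: "\<omega> \<in> space M"
    have s: "0 \<le> (\<Sum>i\<in>{1..N} - {j, l}. below a i \<omega>)"
      by (intro sum_nonneg) simp
    show "max a (competition (pair_cutoff j l a) j \<omega>) \<le>
        ?Q \<omega> + a * below a l \<omega> + a * (\<Sum>i\<in>{1..N} - {j, l}. below a i \<omega>)"
    proof (cases "V l \<omega> < a")
      case True
      then show ?thesis using competition_pair_cutoff[OF assms(1-3) \<omega>, of a] assms s by simp
    next
      case False
      let ?Z = "lowest_bid r ({1..N} - {j}) (\<lambda>i. V i \<omega>)"
      \<comment> \<open>The lowest bid can be below \<open>a\<close> only if some summand equals 1,
        and then the sum alone covers \<open>a\<close>.\<close>
      have "a \<le> ?Z + a * (\<Sum>i\<in>{1..N} - {j, l}. below a i \<omega>)"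
      proof (cases "\<exists>i\<in>{1..N} - {j, l}. V i \<omega> < a")
        case True
        then obtain i where i: "i \<in> {1..N} - {j, l}" "V i \<omega> < a" by blast
        have "1 \<le> (\<Sum>i\<in>{1..N} - {j, l}. below a i \<omega>)"
          using member_le_sum[OF i(1), of "\<lambda>i. below a i \<omega>"] i by simp
        then have "a * 1 \<le> a * (\<Sum>i\<in>{1..N} - {j, l}. below a i \<omega>)"
          using assms by (intro mult_left_mono) auto
        moreover have "0 \<le> ?Z" by (rule lowest_bid_V_nonneg) (use \<omega> in auto)
        ultimately show ?thesis by simp
      next
        case no: False
        have "a \<le> V i \<omega>" if "i \<in> {1..N} - {j}" for i
          using no False that by (cases "i = l") (auto simp: not_less)
        then have "a \<le> ?Z"
          using assms by (simp add: le_lowest_bid_iff)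
        then show ?thesis using s assms by (simp add: add_increasing2)
      qed
      moreover have "0 \<le> a * (\<Sum>i\<in>{1..N} - {j, l}. below a i \<omega>)" using s assms by simp
      ultimately show ?thesis
        using competition_pair_cutoff[OF assms(1-3) \<omega>, of a] False by simp
    qed
  qed (rule competition_integrable)
  also have "\<dots> = expectation ?Q + a * F l a + a * (\<Sum>i\<in>{1..N} - {j, l}. F i a)"
    using int by (rule has_bochner_integral_integral_eq)
  finally show ?thesis .
qed

text \<open>The cases where only \<open>j\<close>, only \<open>l\<close> or both accept. Payments
  are grouped so that each of the first two terms is one seller's acceptance times resale without
  the other seller's item minus the offer, the difference that \<open>offer_le\<close>
  controls.\<close>

lemma profit_pair_cutoff:
  assumes "j \<in> A" "l \<in> A" "j \<noteq> l" "\<omega> \<in> space M"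
  shows "speculator_profit N A r p (cutoff_profile (pair_cutoff j l a)) (\<lambda>i. V i \<omega>) =
    below a j \<omega> * ((1 - below a l \<omega>) * lowest_bid r ({1..N} - {j}) (\<lambda>i. V i \<omega>) - p j) +
    below a l \<omega> * ((1 - below a j \<omega>) * lowest_bid r ({1..N} - {l}) (\<lambda>i. V i \<omega>) - p l) +
    below a j \<omega> * (below a l \<omega> * lowest_bid r ({1..N} - {j, l}) (\<lambda>i. V i \<omega>))"
proof -
  have "\<not> V i \<omega> < 0" if "i \<in> A" for i
    using that A_subset V_nonneg[OF _ assms(4), of i] by auto
  then have "acquired A (cutoff_profile (pair_cutoff j l a)) (\<lambda>i. V i \<omega>) =
      (if V j \<omega> < a then {j} else {}) \<union> (if V l \<omega> < a then {l} else {})"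
    using assms by (auto simp: acquired_def cutoff_profile_def pair_cutoff_def)
  moreover have "auction_revenue N r S (\<lambda>i. V i \<omega>) =
      (if S = {} then 0 else lowest_bid r ({1..N} - S) (\<lambda>i. V i \<omega>))" for S
    using r_pos V_nonneg[OF _ assms(4)] by (intro auction_revenue_eq) auto
  ultimately show ?thesis
    using assms(3) by (cases "V j \<omega> < a"; cases "V l \<omega> < a") (simp_all add: speculator_profit_def insert_commute)
qed

text \<open>By independence each term of \<open>profit_pair_cutoff\<close> factors.
  \<open>offer_le\<close> limits the expected loss in the first two, and the third is a gain of at
  least \<open>F j a * F l a\<close> times the mean lowest bid. The two losses
  \<open>a * F l a\<close> and \<open>a * F j a\<close> together produce the
  \<open>2 * a\<close>.\<close>

lemma expected_profit_pair_cutoff_ge: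
  assumes "j \<in> A" "l \<in> A" "j \<noteq> l" "0 \<le> a" "a \<le> r"
  defines "c \<equiv> pair_cutoff j l a"
  shows "expected_profit M V N A r (cutoff_offer F N A r c) (cutoff_profile c) \<ge>
    F j a * F l a * (expectation (\<lambda>\<omega>. lowest_bid r {1..N} (\<lambda>i. V i \<omega>)) - 2 * a) -
    (F j a + F l a) * a * (\<Sum>i\<in>{1..N} - {j, l}. F i a)"
proof -
  let ?Z = "\<lambda>K \<omega>. lowest_bid r K (\<lambda>i. V i \<omega>)"
  let ?p = "cutoff_offer F N A r c"
  let ?S = "\<Sum>i\<in>{1..N} - {j, l}. F i a"
  \<comment> \<open>\<open>j\<close> and \<open>l\<close> are parameters here, so that the facts
    about \<open>Q\<close> apply with the roles exchanged as well.\<close>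
  define Q where "Q j l \<omega> = (1 - below a l \<omega>) * ?Z ({1..N} - {j}) \<omega>" for j l \<omega>
  define R where "R \<omega> = ?Z ({1..N} - {j, l}) \<omega>" for \<omega>
  have jl: "j \<in> {1..N}" "l \<in> {1..N}" using assms A_subset by auto
  have below: "below a i \<in> borel_measurable M" if "i \<in> {1..N}" for i
    using V_measurable[OF that] by measurable
  have coord: "(\<lambda>u. u i) \<in> borel_measurable (PiM K (\<lambda>_. borel :: real measure))" if "i \<in> K" for i and K :: "nat set"
    using that by measurable
  have Zmeas: "(\<lambda>u. lowest_bid r K u) \<in> borel_measurable (PiM K (\<lambda>_. borel))" if "K \<subseteq> {1..N}" for K
    using finite_subset[OF that] by (intro borel_measurable_lowest_bid coord) auto
  have ind: "(\<lambda>u. indicator {..<a} (u i) :: real) \<in> borel_measurable (PiM K (\<lambda>_. borel))"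
    if "i \<in> K" for i and K :: "nat set"
    using that by measurable
  have Zbound: "\<bar>lowest_bid r K u\<bar> \<le> r" if "K \<subseteq> {1..N}" "\<And>i. i \<in> K \<Longrightarrow> 0 \<le> u i" for K u
  proof -
    have "finite K" using finite_subset[OF that(1)] by simp
    then have "0 \<le> lowest_bid r K u" "lowest_bid r K u \<le> r"
      using that r_pos by (auto simp: le_lowest_bid_iff lowest_bid_le)
    then show ?thesis by simp
  qed
  \<comment> \<open>Only the coordinates in \<open>K\<close> matter, which brings the lowest bid
    into the restricted form required by \<open>expectation_below_mult\<close>.\<close>
  have Z_eq: "?Z K \<omega> = lowest_bid r K (\<lambda>i\<in>K. V i \<omega>)" for K \<omega>
    by (rule lowest_bid_cong) simp
  have QE: "expectation (\<lambda>\<omega>. below a j \<omega> * Q j l \<omega>) = F j a * expectation (Q j l)"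
    and Q_int: "integrable M (\<lambda>\<omega>. below a j \<omega> * Q j l \<omega>)"
    if "j \<in> {1..N}" "l \<in> {1..N}" "j \<noteq> l" for j l
  proof -
    let ?K = "{1..N} - {j}"
    let ?h = "\<lambda>u. (1 - indicator {..<a} (u l)) * lowest_bid r ?K u"
    have Q: "Q j l \<omega> = ?h (\<lambda>i\<in>?K. V i \<omega>)" for \<omega>
      unfolding Q_def Z_eq[of ?K] using that by simp
    have "?h \<in> borel_measurable (PiM ?K (\<lambda>_. borel))"
      using that
      by (intro borel_measurable_times borel_measurable_diff borel_measurable_const ind Zmeas) auto
    moreover have "\<bar>?h u\<bar> \<le> r" if "\<And>i. i \<in> ?K \<Longrightarrow> 0 \<le> u i" for u
      using Zbound[of ?K u] that r_pos by (auto split: split_indicator)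
    ultimately show "expectation (\<lambda>\<omega>. below a j \<omega> * Q j l \<omega>) = F j a * expectation (Q j l)"
      unfolding Q[abs_def] using that by (intro expectation_below_mult) auto
    show "integrable M (\<lambda>\<omega>. below a j \<omega> * Q j l \<omega>)"
    proof (rule integrable_const_bound[where B=r])
      show "(\<lambda>\<omega>. below a j \<omega> * Q j l \<omega>) \<in> borel_measurable M"
        unfolding Q_def using below that lowest_bid_V_measurable[of ?K] by measurable
      show "AE \<omega> in M. norm (below a j \<omega> * Q j l \<omega>) \<le> r"
        using lowest_bid_V_nonneg[of ?K] lowest_bid_V_le[of ?K] r_pos
        by (intro AE_I2) (auto simp: Q_def split: split_indicator)
    qed
  qed
  \<comment> \<open>Independence is used twice: first to split off \<open>j\<close>, then to split
    off \<open>l\<close> from the sellers outside the pair.\<close>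
  have RE: "expectation (\<lambda>\<omega>. below a j \<omega> * (below a l \<omega> * R \<omega>)) = F j a * (F l a * expectation R)"
    and R_int: "integrable M (\<lambda>\<omega>. below a j \<omega> * (below a l \<omega> * R \<omega>))"
  proof -
    let ?K = "{1..N} - {j, l}" and ?L = "{1..N} - {j}"
    let ?h = "\<lambda>u. indicator {..<a} (u l) * lowest_bid r ?K u"
    have h: "below a l \<omega> * R \<omega> = ?h (\<lambda>i\<in>?L. V i \<omega>)" for \<omega>
    proof -
      have "R \<omega> = lowest_bid r ?K (\<lambda>i\<in>?L. V i \<omega>)"
        unfolding R_def by (rule lowest_bid_cong) auto
      then show ?thesis using jl assms by simp
    qed
    have "(\<lambda>u. lowest_bid r ?K u) \<in> borel_measurable (PiM ?L (\<lambda>_. borel))"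
      by (intro borel_measurable_lowest_bid coord) auto
    then have "?h \<in> borel_measurable (PiM ?L (\<lambda>_. borel))"
      using jl assms by (intro borel_measurable_times ind) auto
    moreover have "\<bar>?h u\<bar> \<le> r" if "\<And>i. i \<in> ?L \<Longrightarrow> 0 \<le> u i" for u
      using Zbound[of ?K u] that r_pos by (auto split: split_indicator)
    ultimately have "expectation (\<lambda>\<omega>. below a j \<omega> * (below a l \<omega> * R \<omega>)) =
        F j a * expectation (\<lambda>\<omega>. below a l \<omega> * R \<omega>)"
      unfolding h using jl by (intro expectation_below_mult) auto
    also have "expectation (\<lambda>\<omega>. below a l \<omega> * R \<omega>) = F l a * expectation R"
      unfolding R_def[abs_def] Z_eq[of ?K] using jl Zmeas[of ?K] Zbound[of ?K]
      by (intro expectation_below_mult) auto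
    finally show "expectation (\<lambda>\<omega>. below a j \<omega> * (below a l \<omega> * R \<omega>)) = F j a * (F l a * expectation R)" .
    show "integrable M (\<lambda>\<omega>. below a j \<omega> * (below a l \<omega> * R \<omega>))"
    proof (rule integrable_const_bound[where B=r])
      show "(\<lambda>\<omega>. below a j \<omega> * (below a l \<omega> * R \<omega>)) \<in> borel_measurable M"
        unfolding R_def using below jl lowest_bid_V_measurable[of ?K] by measurable
      show "AE \<omega> in M. norm (below a j \<omega> * (below a l \<omega> * R \<omega>)) \<le> r"
        using lowest_bid_V_nonneg[of ?K] lowest_bid_V_le[of ?K] r_pos
        by (intro AE_I2) (auto simp: R_def split: split_indicator)
    qed
  qed
  have "expected_profit M V N A r ?p (cutoff_profile c) =
      expectation (\<lambda>\<omega>. (below a j \<omega> * Q j l \<omega> - ?p j * below a j \<omega>) +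
        (below a l \<omega> * Q l j \<omega> - ?p l * below a l \<omega>) + below a j \<omega> * (below a l \<omega> * R \<omega>))"
    unfolding expected_profit_def c_def
    by (intro Bochner_Integration.integral_cong refl)
       (simp add: profit_pair_cutoff[OF assms(1-3)] Q_def R_def algebra_simps)
  also have "\<dots> = (F j a * expectation (Q j l) - ?p j * F j a) +
      (F l a * expectation (Q l j) - ?p l * F l a) + F j a * (F l a * expectation R)"
    using jl assms(3) QE Q_int RE R_int
    by (intro has_bochner_integral_integral_eq has_bochner_integral_add has_bochner_integral_diff
        has_bochner_integral_mult_right has_integral_below)
       (auto simp only: has_bochner_integral_iff)
  also have "\<dots> = F j a * (expectation (Q j l) - ?p j) + F l a * (expectation (Q l j) - ?p l) +
      F j a * F l a * expectation R"
    by (simp add: algebra_simps)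
  \<comment> \<open>\<open>offer_le\<close> is applied once for each buyer-seller pair, and removing
    \<open>j\<close> and \<open>l\<close> from the bidders can only raise the lowest bid.\<close>
  also have "\<dots> \<ge> F j a * (- (a * F l a + a * ?S)) + F l a * (- (a * F j a + a * ?S)) +
      F j a * F l a * expectation (?Z {1..N})"
  proof (intro add_mono mult_left_mono mult_nonneg_nonneg F_nonneg jl)
    show "- (a * F l a + a * ?S) \<le> expectation (Q j l) - ?p j"
      using offer_le[OF assms(1-5)] by (simp add: c_def Q_def[abs_def])
    show "- (a * F j a + a * ?S) \<le> expectation (Q l j) - ?p l"
      using offer_le[of l j a] assms
      by (simp add: c_def Q_def[abs_def] pair_cutoff_commute[of l j] insert_commute)
    have int: "integrable M (?Z K)" if "K \<subseteq> {1..N}" for K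
      using lowest_bid_V_le[OF that] lowest_bid_V_nonneg[OF that] lowest_bid_V_measurable[OF that]
      by (intro integrable_const_bound[where B=r] AE_I2) auto
    show "expectation (?Z {1..N}) \<le> expectation R"
      unfolding R_def by (intro integral_mono int lowest_bid_antimono) auto
  qed
  finally show ?thesis by (simp add: algebra_simps)
qed

end

section \<open>Choosing the pair and the cutoff\<close>

theorem proposition2:
  fixes N :: nat and A :: "nat set" and r :: real
    and M :: "'a measure" and V :: "nat \<Rightarrow> 'a \<Rightarrow> real"
    and F :: "nat \<Rightarrow> real \<Rightarrow> real" and f :: "nat \<Rightarrow> real \<Rightarrow> ennreal"
    and k k' :: nat
  assumes "N \<ge> 2" and "A \<subseteq> {1..N}" and "0 < r" and "r \<le> 1"
    and "prob_space M"
    and "prob_space.indep_vars M (\<lambda>_. borel) V {1..N}"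
    and "\<And>i \<omega>. i \<in> {1..N} \<Longrightarrow> \<omega> \<in> space M \<Longrightarrow> V i \<omega> \<in> {0..1}"
    and "\<And>i. i \<in> {1..N} \<Longrightarrow> distributed M lborel (V i) (f i)"
    and "\<And>i. i \<in> {1..N} \<Longrightarrow> F i = cdf (distr M borel (V i))"
    and "\<And>i. i \<in> {1..N} \<Longrightarrow> F i 0 = 0"
    and "\<And>i v. i \<in> {1..N} \<Longrightarrow> 0 < v \<Longrightarrow> v \<le> 1 \<Longrightarrow> 0 < F i v"
    and "k \<in> A" and "k' \<in> A" and "k \<noteq> k'"
    and "\<And>i. i \<in> {1..N} - A \<Longrightarrow> ((\<lambda>v. v * F i v / F k v) \<longlongrightarrow> 0) (at_right 0)"
    and "\<And>i. i \<in> {1..N} - A \<Longrightarrow> ((\<lambda>v. v * F i v / F k' v) \<longlongrightarrow> 0) (at_right 0)"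
  shows "\<exists>c. (\<forall>j\<in>A. c j \<in> {0..r}) \<and>
           acceptance_equilibrium M V N A r (cutoff_offer F N A r c) (cutoff_profile c) \<and>
           expected_profit M V N A r (cutoff_offer F N A r c) (cutoff_profile c) > 0"
proof -
  have distributed_V: "V i \<in> borel_measurable M" if "i \<in> {1..N}" for i
    using assms(8)[OF that] by (simp add: distributed_def)
  interpret prob_space M by fact
  interpret procurement M V N A r F
  proof
    fix i x assume i: "i \<in> {1..N}"
    have "F i x = prob (V i -` {..x} \<inter> space M)"
      using assms(9)[OF i] distributed_V[OF i] by (simp add: cdf_def2 measure_distr)
    also have "V i -` {..x} \<inter> space M = {\<omega> \<in> space M. V i \<omega> \<le> x}" by auto
    finally show "F i x = prob {\<omega> \<in> space M. V i \<omega> \<le> x}" .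
    \<comment> \<open>A law with a Lebesgue density has no atoms, since singletons are null
      sets.\<close>
    have "emeasure M (V i -` {x} \<inter> space M) = (\<integral>\<^sup>+ y. f i y * indicator {x} y \<partial>lborel)"
      using assms(8)[OF i] by (rule distributed_emeasure) simp
    also have "\<dots> = 0"
      by (intro nn_integral_null_set) (simp add: null_sets_def)
    also have "V i -` {x} \<inter> space M = {\<omega> \<in> space M. V i \<omega> = x}" by auto
    finally show "prob {\<omega> \<in> space M. V i \<omega> = x} = 0" by (simp add: measure_def)
  qed (use assms(1-7) in auto)
  define \<mu> where "\<mu> = expectation (\<lambda>\<omega>. lowest_bid r {1..N} (\<lambda>i. V i \<omega>))"
  have "0 < \<mu>" unfolding \<mu>_def by (rule expectation_lowest_bid_pos) (use assms(10) in simp)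
  \<comment> \<open>The error terms will amount to \<open>2 * \<eta>\<close> from the factor
    \<open>2 * a\<close> and \<open>N * \<eta>\<close> from the other sellers for each of
    \<open>j\<close> and \<open>l\<close>. Their total is below
    \<open>4 * N * \<eta> = \<mu>\<close> because \<open>N > 1\<close>.\<close>
  define \<eta> where "\<eta> = \<mu> / (4 * N)"
  have "0 < \<eta>" using \<open>0 < \<mu>\<close> assms(1) by (simp add: \<eta>_def)
  have "(2 + 2 * N) * \<eta> < 4 * N * \<eta>"
    using \<open>0 < \<eta>\<close> assms(1) by (intro mult_strict_right_mono) auto
  also have "\<dots> = \<mu>" using assms(1) by (simp add: \<eta>_def)
  finally have \<eta>: "2 * \<eta> + 2 * N * \<eta> < \<mu>" by (simp add: algebra_simps)
  \<comment> \<open>The limit hypothesis with the division cleared, which is possible because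
    \<open>F m v\<close> is positive on \<open>(0, 1]\<close>.\<close>
  have small: "\<forall>\<^sub>F v in at_right 0. \<forall>i\<in>{1..N} - A. v * F i v \<le> \<eta> * F m v"
    if m: "m \<in> A" and lim: "\<And>i. i \<in> {1..N} - A \<Longrightarrow> ((\<lambda>v. v * F i v / F m v) \<longlongrightarrow> 0) (at_right 0)" for m
  proof (intro eventually_ball_finite ballI)
    fix i assume "i \<in> {1..N} - A"
    then have "\<forall>\<^sub>F v in at_right 0. v * F i v / F m v < \<eta>"
      using lim \<open>0 < \<eta>\<close> by (intro order_tendstoD(2)) auto
    moreover have "\<forall>\<^sub>F v in at_right 0. v \<in> {0<..<1::real}"
      by (rule eventually_at_right_real) simp
    ultimately show "\<forall>\<^sub>F v in at_right 0. v * F i v \<le> \<eta> * F m v"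
    proof eventually_elim
      case (elim v)
      moreover have "0 < F m v" using elim m assms(2) by (intro assms(11)) auto
      ultimately show ?case by (simp add: divide_less_eq)
    qed
  qed simp
  have "\<forall>\<^sub>F v in at_right 0. \<forall>i\<in>{1..N} - A. v * F i v \<le> \<eta> * F k v"
    by (rule small) (use assms(12,15) in auto)
  moreover have "\<forall>\<^sub>F v in at_right 0. \<forall>i\<in>{1..N} - A. v * F i v \<le> \<eta> * F k' v"
    by (rule small) (use assms(13,16) in auto)
  moreover have "\<forall>\<^sub>F v in at_right 0. v \<in> {0<..<min \<eta> r}"
    using \<open>0 < \<eta>\<close> assms(3) by (intro eventually_at_right_real) simp
  ultimately have "\<forall>\<^sub>F v in at_right 0. v \<in> {0<..<min \<eta> r} \<and>
      (\<forall>i\<in>{1..N} - A. v * F i v \<le> \<eta> * F k v \<and> v * F i v \<le> \<eta> * F k' v)"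
    by eventually_elim blast
  from eventually_happens'[OF trivial_limit_at_right_real this]
  obtain a where "a \<in> {0<..<min \<eta> r}"
    and out: "\<And>i. i \<in> {1..N} - A \<Longrightarrow> a * F i a \<le> \<eta> * F k a \<and> a * F i a \<le> \<eta> * F k' a"
    by blast
  then have a: "0 < a" "a < \<eta>" "a < r" by auto
  have arg_max: "\<exists>j\<in>B. \<forall>i\<in>B. F i a \<le> F j a" if "finite B" "B \<noteq> {}" for B
  proof (intro bexI[of _ "arg_min_on (\<lambda>i. - F i a) B"] ballI)
    show "F i a \<le> F (arg_min_on (\<lambda>i. - F i a) B) a" if "i \<in> B" for i
      using arg_min_least[OF \<open>finite B\<close> \<open>B \<noteq> {}\<close> that, of "\<lambda>i. - F i a"] by simp
  qed (rule arg_min_if_finite(1)[OF that])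
  have "finite A" using assms(2) finite_subset by auto
  \<comment> \<open>The pair is chosen after \<open>a\<close>: \<open>j\<close> and \<open>l\<close>
    are the sellers in \<open>A\<close> most likely to be below this particular \<open>a\<close>,
    and need not be \<open>k\<close> and \<open>k'\<close>.\<close>
  obtain j where j: "j \<in> A" "\<And>i. i \<in> A \<Longrightarrow> F i a \<le> F j a"
    using arg_max[of A] \<open>finite A\<close> assms(12) by blast
  obtain l where l: "l \<in> A" "l \<noteq> j" "\<And>i. i \<in> A - {j} \<Longrightarrow> F i a \<le> F l a"
    using arg_max[of "A - {j}"] \<open>finite A\<close> assms(12-14) by blast
  have lj: "F l a \<le> F j a" by (rule j(2)) (rule l(1))
  have pos: "0 < F l a" using l(1) a assms(2,4) by (intro assms(11)) auto
  have small_l: "a * F i a \<le> \<eta> * F l a" if i: "i \<in> {1..N} - {j, l}" for i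
  proof (cases "i \<in> A")
    \<comment> \<open>Inside \<open>A\<close> the choice of \<open>l\<close> gives the bound, with
      \<open>a < \<eta>\<close>.\<close>
    case True
    then have "F i a \<le> F l a" using i by (intro l(3)) auto
    then show ?thesis using a i by (intro mult_mono F_nonneg) auto
  next
    case False
    \<comment> \<open>At least one of \<open>k\<close> and \<open>k'\<close> differs from
      \<open>j\<close> and so competed with \<open>l\<close> in the choice of the maximum over
      \<open>A - {j}\<close>.\<close>
    have "F k a \<le> F l a \<or> F k' a \<le> F l a" using l(3)[of k] l(3)[of k'] assms(12-14) by auto
    then have "\<eta> * F k a \<le> \<eta> * F l a \<or> \<eta> * F k' a \<le> \<eta> * F l a"
      using mult_left_mono[OF _ less_imp_le[OF \<open>0 < \<eta>\<close>]] by blast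
    moreover have "a * F i a \<le> \<eta> * F k a" "a * F i a \<le> \<eta> * F k' a"
      using out[of i] False i by auto
    ultimately show ?thesis by linarith
  qed
  define S where "S = (\<Sum>i\<in>{1..N} - {j, l}. F i a)"
  have "a * S \<le> card ({1..N} - {j, l}) * (\<eta> * F l a)"
    unfolding S_def sum_distrib_left by (rule sum_bounded_above) (rule small_l)
  also have "\<dots> \<le> N * (\<eta> * F l a)"
    using card_mono[of "{1..N}" "{1..N} - {j, l}"] \<open>0 < \<eta>\<close> pos by (intro mult_right_mono) auto
  finally have S_l: "a * S \<le> N * (\<eta> * F l a)" .
  also have "\<dots> \<le> N * (\<eta> * F j a)"
    using lj \<open>0 < \<eta>\<close> by (intro mult_left_mono) auto
  finally have S_j: "a * S \<le> N * (\<eta> * F j a)" .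
  \<comment> \<open>The sum over third sellers is weighted by \<open>F j a\<close> and by
    \<open>F l a\<close>. Bounding it by \<open>S_l\<close> in the first case and by
    \<open>S_j\<close> in the second makes every error a multiple of \<open>F j a * F l a\<close>,
    comparable with the gain.\<close>
  have "0 < F j a * F l a * (\<mu> - (2 * \<eta> + 2 * N * \<eta>))"
    using pos lj \<eta> by simp
  also have "\<dots> = F j a * F l a * (\<mu> - 2 * \<eta>) -
      (F j a * (N * (\<eta> * F l a)) + F l a * (N * (\<eta> * F j a)))"
    by (simp add: algebra_simps)
  also have "\<dots> \<le> F j a * F l a * (\<mu> - 2 * a) - (F j a * (a * S) + F l a * (a * S))"
    using pos lj a S_l S_j by (intro diff_mono add_mono mult_left_mono) auto
  also have "\<dots> = F j a * F l a * (\<mu> - 2 * a) - (F j a + F l a) * a * S"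
    by (simp add: algebra_simps)
  also have "\<dots> \<le> expected_profit M V N A r (cutoff_offer F N A r (pair_cutoff j l a))
      (cutoff_profile (pair_cutoff j l a))"
    unfolding \<mu>_def S_def using j(1) l(1,2) a by (intro expected_profit_pair_cutoff_ge) auto
  finally have profit: "0 < expected_profit M V N A r (cutoff_offer F N A r (pair_cutoff j l a))
      (cutoff_profile (pair_cutoff j l a))" .
  have range: "pair_cutoff j l a i \<in> {0..r}" for i
    using a assms(3) by (simp add: pair_cutoff_def)
  show ?thesis
    using range acceptance_equilibrium_cutoff[OF range] profit
    by (intro exI[of _ "pair_cutoff j l a"]) simp
qed

end
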